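(* Let $U_h\subset U$ be a linear subspace and let $\mathcal{M}_n\subset V$ be a neural-network-parameterized set. Suppose that the bilinear form $b(\cdot,\cdot)$, equivalently the operator $B:U\to\mathcal{M}_n^*$, is bounded with norm $\|B\|$, and that $b$ satisfies the inf-sup condition with constant $\mu>0$: $$\inf_{w\in U\setminus\{0\}}\ \sup_{v\in V\setminus\{0\}}\frac{|b(w,v)|}{\|w\|_U\|v\|_V}\ge\mu .$$ Assume that a Fortin operator $\Pi:V\to\mathcal{M}_n$ exists, with stability constant $C_\Pi$. Let $u\in U$ be the solution of $b(u,v)=f(v)$ for all $v\in V$, and let $u_h\in U_h$ be a solution of the discrete minimal-residual problem $$u_h\in\arg\min_{w_h\in U_h}\ \sup_{v_n\in\mathcal{M}_n\setminus\{0\}}\frac{\langle f-Bw_h,v_n\rangle}{\|v_n\|_V}.$$ Then $$\|u-u_h\|_U\le\left(1+\frac{2C_\Pi\|B\|}{\mu}\right)\inf_{w_h\in U_h}\|u-w_h\|_U .$$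
   Context: $U$ and $V$ are real Hilbert spaces with duals $U^*,V^*$; $B:U\to V^*$ is a bounded linear operator, $b(u,v):=\langle Bu,v\rangle_{V^*,V}$, and $f\in V^*$. $\mathcal{M}_n\subset V$ is a set (not necessarily a linear space) of functions given by neural networks; it carries the norm of $V$. The norm of $B:U\to\mathcal{M}_n^*$ is $\|B\|:=\sup_{w\in U\setminus\{0\}}\sup_{v_n\in\mathcal{M}_n\setminus\{0\}}\frac{|\langle Bw,v_n\rangle|}{\|w\|_U\|v_n\|_V}$. Fortin operator: a linear operator $\Pi:V\to V$ taking values in $\mathcal{M}_n$ (written $\Pi:V\to\mathcal{M}_n$) such that (1) $\|\Pi v\|_V\le C_\Pi\|v\|_V$ for all $v\in V$, for some constant $C_\Pi>0$; (2) $b(u_h,v-\Pi v)=0$ for all $u_h\in U_h$ and all $v\in V$. *)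

theory Defs
  imports "HOL-Analysis.Analysis"
begin

text \<open>
  The dual of a real Hilbert space \<open>'v\<close> is \<open>'v \<Rightarrow>\<^sub>L real\<close>, so a bounded operator
  \<open>B : U \<rightarrow> V\<^sup>*\<close> is a term of type \<open>'u \<Rightarrow>\<^sub>L 'v \<Rightarrow>\<^sub>L real\<close>, with \<open>b(w,v) = B w v\<close>.
  Suprema and infima of nonnegative quotients are taken in \<open>[0,\<infinity>]\<close>, so that
  \<open>sup \<emptyset> = 0\<close> and \<open>inf \<emptyset> = \<infinity>\<close> in degenerate cases.
\<close>

text \<open>The set \<open>M\<close> need not be a linear space.  The supremum is finite because \<open>B\<close> is
  bounded into the full dual (\<open>operator_norm_on_finite\<close>), so \<^const>\<open>enn2real\<close> loses nothing.\<close>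

definition operator_norm_on ::
    "'v set \<Rightarrow> ('u::real_normed_vector \<Rightarrow>\<^sub>L 'v::real_normed_vector \<Rightarrow>\<^sub>L real) \<Rightarrow> real" where
  "operator_norm_on M B = enn2real
     (SUP w\<in>UNIV - {0}. SUP v\<in>M - {0}. ennreal (\<bar>B w v\<bar> / (norm w * norm v)))"

definition inf_sup_condition ::
    "('u::real_normed_vector \<Rightarrow>\<^sub>L 'v::real_normed_vector \<Rightarrow>\<^sub>L real) \<Rightarrow> real \<Rightarrow> bool" where
  "inf_sup_condition B \<mu> \<longleftrightarrow> ennreal \<mu> \<le>
     (INF w\<in>UNIV - {0}. SUP v\<in>UNIV - {0}. ennreal (\<bar>B w v\<bar> / (norm w * norm v)))"

definition fortin_operator ::
    "('u::real_normed_vector \<Rightarrow>\<^sub>L 'v::real_normed_vector \<Rightarrow>\<^sub>L real) \<Rightarrow> 'u set \<Rightarrow> 'v set \<Rightarrow>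
     real \<Rightarrow> ('v \<Rightarrow> 'v) \<Rightarrow> bool" where
  "fortin_operator B Uh M C F \<longleftrightarrow>
     linear F \<and> range F \<subseteq> M \<and>
     C > 0 \<and> (\<forall>v. norm (F v) \<le> C * norm v) \<and>
     (\<forall>uh\<in>Uh. \<forall>v. B uh (v - F v) = 0)"

text \<open>The quotients carry no absolute value and \<open>M\<close> need not be symmetric, so the supremum of
  a signed quantity is taken in the extended reals.\<close>

definition discrete_dual_sup ::
    "'v set \<Rightarrow> ('v::real_normed_vector \<Rightarrow>\<^sub>L real) \<Rightarrow> ereal" where
  "discrete_dual_sup M g = (SUP v\<in>M - {0}. ereal (g v / norm v))"

lemma operator_norm_on_finite:
  fixes B :: "'u::real_normed_vector \<Rightarrow>\<^sub>L 'v::real_normed_vector \<Rightarrow>\<^sub>L real"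
  shows "(SUP w\<in>UNIV - {0}. SUP v\<in>M - {0}. ennreal (\<bar>B w v\<bar> / (norm w * norm v))) < \<infinity>"
proof -
  have "\<bar>B w v\<bar> / (norm w * norm v) \<le> norm B" if "w \<noteq> 0" "v \<noteq> 0" for w v
  proof -
    have "\<bar>B w v\<bar> \<le> norm (B w) * norm v"
      using norm_blinfun[of "B w" v] by simp
    also have "\<dots> \<le> norm B * norm w * norm v"
      by (intro mult_right_mono norm_blinfun norm_ge_zero)
    finally show ?thesis
      using that by (simp add: divide_simps mult.assoc)
  qed
  then have "(SUP w\<in>UNIV - {0}. SUP v\<in>M - {0}. ennreal (\<bar>B w v\<bar> / (norm w * norm v)))
      \<le> ennreal (norm B)"
    by (intro SUP_least ennreal_leI) auto
  then show ?thesis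
    by (simp add: le_less_trans)
qed

end

theory Submission
  imports Defs
begin

text \<open>
  For \<open>w\<^sub>h \<in> U\<^sub>h\<close> the difference \<open>u\<^sub>h - w\<^sub>h\<close> lies in \<open>U\<^sub>h\<close>, so the Fortin property moves the
  inf-sup condition to test functions \<open>\<Pi> v \<in> M\<close>.  There \<open>b(u\<^sub>h - w\<^sub>h, \<Pi> v)\<close> is the difference of the
  residuals of \<open>w\<^sub>h\<close> and \<open>u\<^sub>h\<close>; minimality bounds the latter by the former, which is at most
  \<open>\<parallel>B\<parallel> \<parallel>u - w\<^sub>h\<parallel>\<close>.  The residual functional is not symmetric, since \<open>M\<close> is not, but signs can be
  switched on the range of \<open>\<Pi>\<close>, which is a linear subspace contained in \<open>M\<close>.
\<close>

text \<open>Since the defining supremum is finite, \<open>enn2real\<close> keeps its value instead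
  of sending infinity to 0, so each quotient is bounded by it.\<close>

lemma abs_le_operator_norm_on:
  fixes B :: "'u::real_normed_vector \<Rightarrow>\<^sub>L 'v::real_normed_vector \<Rightarrow>\<^sub>L real"
  assumes "v \<in> M"
  shows "\<bar>B w v\<bar> \<le> operator_norm_on M B * norm w * norm v"
proof (cases "w = 0 \<or> v = 0")
  case True
  then show ?thesis by auto
next
  case False
  let ?S = "SUP w\<in>UNIV - {0}. SUP v\<in>M - {0}. ennreal (\<bar>B w v\<bar> / (norm w * norm v))"
  have "ennreal (\<bar>B w v\<bar> / (norm w * norm v)) \<le> ?S"
    using False assms by (intro SUP_upper2[of w] SUP_upper) auto
  moreover have "ennreal (enn2real ?S) = ?S"
    using operator_norm_on_finite[where M = M and B = B] by simp
  ultimately have "ennreal (\<bar>B w v\<bar> / (norm w * norm v)) \<le> ennreal (operator_norm_on M B)"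
    by (simp add: operator_norm_on_def)
  then have "\<bar>B w v\<bar> / (norm w * norm v) \<le> operator_norm_on M B"
    by (simp add: operator_norm_on_def)
  then show ?thesis
    using False by (simp add: divide_simps mult.assoc)
qed

lemma discrete_dual_sup_leI:
  fixes g :: "'v::real_normed_vector \<Rightarrow>\<^sub>L real"
  assumes "\<And>v. v \<in> M \<Longrightarrow> g v \<le> K * norm v"
  shows "discrete_dual_sup M g \<le> ereal K"
  unfolding discrete_dual_sup_def
  using assms by (intro SUP_least) (auto simp: divide_simps)

lemma discrete_dual_sup_leD:
  fixes g :: "'v::real_normed_vector \<Rightarrow>\<^sub>L real"
  assumes "discrete_dual_sup M g \<le> ereal K" "v \<in> M"
  shows "g v \<le> K * norm v"
proof (cases "v = 0")
  case False
  then have "ereal (g v / norm v) \<le> ereal K"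
    using assms by (auto simp: discrete_dual_sup_def SUP_le_iff)
  then show ?thesis
    using False by (simp add: divide_simps)
qed (simp add: blinfun.zero_right)

text \<open>Turns the inf-sup condition into a lower bound on the functional \<open>B w\<close>. The
  assumption \<open>K \<ge> 0\<close> covers \<open>w = 0\<close> and a trivial test space, where
  the supremum is empty and equals 0.\<close>

lemma inf_sup_condition_norm_le:
  fixes B :: "'u::real_normed_vector \<Rightarrow>\<^sub>L 'v::real_normed_vector \<Rightarrow>\<^sub>L real"
  assumes "inf_sup_condition B \<mu>" "K \<ge> 0" "\<And>v. \<bar>B w v\<bar> \<le> K * norm v"
  shows "\<mu> * norm w \<le> K"
proof (cases "w = 0")
  case False
  have "ennreal \<mu> \<le> (SUP v\<in>UNIV - {0}. ennreal (\<bar>B w v\<bar> / (norm w * norm v)))"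
    using assms(1) False by (auto simp: inf_sup_condition_def le_INF_iff)
  also have "\<dots> \<le> ennreal (K / norm w)"
    using assms(3) False by (intro SUP_least ennreal_leI) (auto simp: divide_simps)
  finally show ?thesis
    using assms(2) False by (simp add: divide_simps)
qed (use assms in simp)

theorem theorem3:
  fixes B :: "'u::{real_inner,complete_space} \<Rightarrow>\<^sub>L 'v::{real_inner,complete_space} \<Rightarrow>\<^sub>L real"
    and f :: "'v \<Rightarrow>\<^sub>L real"
    and Uh :: "'u set"
    and M :: "'v set"
    and F :: "'v \<Rightarrow> 'v"
    and \<mu> C :: real
    and u uh :: 'u
  assumes "subspace Uh"
    and "\<mu> > 0"
    and "inf_sup_condition B \<mu>"
    and "fortin_operator B Uh M C F"
    and "\<forall>v. B u v = f v"
    and "is_arg_min (\<lambda>wh. discrete_dual_sup M (f - B wh)) (\<lambda>wh. wh \<in> Uh) uh"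
  shows "norm (u - uh) \<le>
    (1 + 2 * C * operator_norm_on M B / \<mu>) * (INF wh\<in>Uh. norm (u - wh))"
proof -
  let ?N = "operator_norm_on M B"
  let ?K = "1 + 2 * C * ?N / \<mu>"
  have N: "?N \<ge> 0"
    by (simp add: operator_norm_on_def)
  have F: "linear F" "\<And>v. F v \<in> M" "C > 0" "\<And>v. norm (F v) \<le> C * norm v"
    "\<And>w v. w \<in> Uh \<Longrightarrow> B w (v - F v) = 0"
    using assms(4) by (auto simp: fortin_operator_def)
  have uh: "uh \<in> Uh"
    using assms(6) by (simp add: is_arg_min_def)
  have K: "?K > 0"
    using N F(3) assms(2) by (simp add: add_pos_nonneg)
  have f: "f = B u"
    using assms(5) by (intro blinfun_eqI) simp
  have bound: "norm (u - uh) \<le> ?K * norm (u - wh)" if wh: "wh \<in> Uh" for wh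
  proof -
    let ?R = "?N * norm (u - wh)"
    have res: "\<bar>(f - B wh) v\<bar> \<le> ?R * norm v" if "v \<in> M" for v
      using abs_le_operator_norm_on[OF that, of B "u - wh"]
      by (simp add: f blinfun.diff_right)
    \<comment> \<open>Minimality compares signed suprema, so at first it controls the residual of
      \<open>uh\<close> from above only.\<close>
    have "discrete_dual_sup M (f - B uh) \<le> discrete_dual_sup M (f - B wh)"
      using assms(6) wh by (auto simp: is_arg_min_def not_less)
    also have "\<dots> \<le> ereal ?R"
      using res by (intro discrete_dual_sup_leI) (meson abs_le_D1)
    finally have min: "(f - B uh) v \<le> ?R * norm v" if "v \<in> M" for v
      using that by (rule discrete_dual_sup_leD)
    have "\<bar>B (uh - wh) v\<bar> \<le> 2 * C * ?R * norm v" for v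
    proof -
      have neg: "F (- v) = - F v"
        by (rule linear_neg[OF F(1)])
      have "\<bar>(f - B uh) (F v)\<bar> \<le> ?R * norm (F v)"
        using min[OF F(2)[of v]] min[OF F(2)[of "- v"]]
        by (simp add: neg blinfun.minus_right abs_le_iff)
      \<comment> \<open>Fortin orthogonality replaces \<open>v\<close> by \<open>F v\<close>; then
        \<open>f\<close> cancels in the difference of residuals.\<close>
      moreover have "B (uh - wh) v = (f - B wh) (F v) - (f - B uh) (F v)"
        using F(5)[OF subspace_diff[OF assms(1) uh wh], of v]
        by (simp add: blinfun.diff_left blinfun.diff_right)
      \<comment> \<open>The factor 2 arises here: each of the two residuals contributes one
        \<open>?R\<close>.\<close>
      ultimately have "\<bar>B (uh - wh) v\<bar> \<le> 2 * ?R * norm (F v)"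
        using res[OF F(2)[of v]] by linarith
      also have "\<dots> \<le> 2 * ?R * (C * norm v)"
        using N F(4) by (intro mult_left_mono) auto
      finally show ?thesis
        by (simp add: mult_ac)
    qed
    then have "\<mu> * norm (uh - wh) \<le> 2 * C * ?R"
      using assms(3) N F(3) by (intro inf_sup_condition_norm_le) auto
    then have "norm (uh - wh) \<le> 2 * C * ?N / \<mu> * norm (u - wh)"
      using assms(2) by (simp add: field_simps)
    moreover have "norm (u - uh) \<le> norm (u - wh) + norm (uh - wh)"
      using norm_triangle_ineq4[of "u - wh" "uh - wh"] by simp
    ultimately show ?thesis
      by (simp add: distrib_right)
  qed
  \<comment> \<open>Dividing by \<open>?K > 0\<close> first gives a lower bound independent of
    \<open>wh\<close>, which passes to the infimum; \<open>uh\<close> witnesses that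
    \<open>Uh\<close> is nonempty.\<close>
  have "norm (u - uh) / ?K \<le> (INF wh\<in>Uh. norm (u - wh))"
    using uh bound K by (intro cINF_greatest) (auto simp: pos_divide_le_eq mult.commute)
  then show ?thesis
    using K by (simp add: pos_divide_le_eq mult.commute)
qed

end
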